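(* Let $$f(\zeta,u)=(k_0\zeta)^{2ik_1}+g\,\zeta,$$ where $k_0,k_1$ are nonzero real constants and $g=g(u)$ is a complex-valued function (class $\mathrm{AP}_{13}$). For the corresponding vacuum pp-wave the following are equivalent: (i) $d\alpha\wedge d\nu=0$; (ii) $Y=0$; (iii) $g=0$.
   Context: Setting. Everything is local, on a small connected coordinate domain (with $\zeta\neq0$, and a fixed branch of the power) with coordinates $(\zeta,\zeta^*,u,v)$, $\zeta$ complex, $u,v$ real; $^*$ (or a bar) is complex conjugation. A (non-flat) vacuum pp-wave is a metric $ds^2=2\,d\zeta\,d\bar\zeta-2\,du\,dv-2(f+\bar f)\,du^2$ with $f=f(\zeta,u)$ complex analytic in $\zeta$, smooth in $u$, $f_{\zeta\zeta}\neq0$ everywhere. Equalities are meant identically on the domain. Normalized tetrad and scalars. Let $a=\tfrac14\log f_{\zeta\zeta}$ and $\alpha=e^{a-a^*}(a_\zeta)^*$ (which is nowhere zero here). Write $\zeta=Z(a,u)$, $L=\log Z_a$ (functions of $(a,u)$), and let $\omega^1=(\alpha^* )^{-1}da=e^{a-a^*}(d\zeta-Z_u\,du)$, $\omega^2=(\omega^1)^*$, $\omega^3=e^{a+a^*}du$, $\omega^4=e^{-a-a^*}\big((f+f^*+Z_uZ_u^* )du+dv-Z_u\,d\zeta^*-Z_u^*\,d\zeta\big)$, so the metric is $2\omega^1\omega^2-2\omega^3\omega^4$. Its dual frame $(\delta,\delta^*,\Delta,D)$ is the null tetrad normalized by $\Psi_4=1$, $\gamma=0$ (Newman–Penrose notation).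 On functions of $(a,a^*,u)$: $\delta Q=\alpha^*Q_a$, $\delta^*Q=\alpha Q_{a^*}$, $\Delta Q=e^{-a-a^*}Q_u$ ($a,a^*$ fixed), $DQ=0$. The remaining spin coefficients are $\mu=e^{-a-a^*}L_u$ (zero here) and $\nu=e^{-a-3a^*}(Z_{uu}+(f_\zeta)^* )$. Invariants: $A=\delta^*\alpha/\alpha^2$ and $Y=(3-A)\nu-1/\alpha+(\Delta\mu+\mu^2)/\alpha^*$. *)

theory Defs
  imports "HOL-Analysis.Analysis"
begin

text \<open>
  Points of the coordinate domain are triples \<open>(\<zeta>, u, v)\<close> with \<open>\<zeta>\<close> complex and \<open>u\<close>, \<open>v\<close> real.
  The coordinate \<open>\<zeta>\<^sup>*\<close> is the conjugate of \<open>\<zeta>\<close>; a complex-valued function of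
  \<open>(\<zeta>, \<zeta>\<^sup>*, u, v)\<close> is a function of the triple that is differentiable in the real sense, and
  its derivatives with respect to \<open>\<zeta>\<close> and \<open>\<zeta>\<^sup>*\<close> are the Wirtinger derivatives.
\<close>

type_synonym point = "complex \<times> real \<times> real"


section \<open>Differential calculus on the domain\<close>

primrec Ck_on :: "nat \<Rightarrow> 'a::real_normed_vector set \<Rightarrow> ('a \<Rightarrow> 'b::real_normed_vector) \<Rightarrow> bool" where
  "Ck_on 0 S F \<longleftrightarrow> continuous_on S F"
| "Ck_on (Suc k) S F \<longleftrightarrow>
     F differentiable_on S \<and> (\<forall>X. Ck_on k S (\<lambda>p. frechet_derivative F (at p) X))"

text \<open>For open \<open>S\<close> in a finite-dimensional space this is the usual notion of a smooth function.\<close>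

definition smooth_on :: "'a::real_normed_vector set \<Rightarrow> ('a \<Rightarrow> 'b::real_normed_vector) \<Rightarrow> bool" where
  "smooth_on S F \<longleftrightarrow> (\<forall>k. Ck_on k S F)"

definition ext_d :: "(point \<Rightarrow> complex) \<Rightarrow> point \<Rightarrow> point \<Rightarrow> complex" where
  "ext_d Q p = frechet_derivative Q (at p)"

definition wedge :: "(point \<Rightarrow> complex) \<Rightarrow> (point \<Rightarrow> complex) \<Rightarrow> point \<Rightarrow> point \<Rightarrow> complex" where
  "wedge \<phi> \<psi> X Y = \<phi> X * \<psi> Y - \<phi> Y * \<psi> X"

definition d_zeta :: "(point \<Rightarrow> complex) \<Rightarrow> point \<Rightarrow> complex" where
  "d_zeta Q p = (ext_d Q p (1, 0, 0) - \<i> * ext_d Q p (\<i>, 0, 0)) / 2"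

definition d_zeta_bar :: "(point \<Rightarrow> complex) \<Rightarrow> point \<Rightarrow> complex" where
  "d_zeta_bar Q p = (ext_d Q p (1, 0, 0) + \<i> * ext_d Q p (\<i>, 0, 0)) / 2"

definition d_u :: "(point \<Rightarrow> complex) \<Rightarrow> point \<Rightarrow> complex" where
  "d_u Q p = ext_d Q p (0, 1, 0)"

definition d_v :: "(point \<Rightarrow> complex) \<Rightarrow> point \<Rightarrow> complex" where
  "d_v Q p = ext_d Q p (0, 0, 1)"


section \<open>Vacuum pp-waves\<close>

definition f_z :: "(complex \<Rightarrow> real \<Rightarrow> complex) \<Rightarrow> complex \<Rightarrow> real \<Rightarrow> complex" where
  "f_z f \<zeta> u = deriv (\<lambda>z. f z u) \<zeta>"

definition f_zz :: "(complex \<Rightarrow> real \<Rightarrow> complex) \<Rightarrow> complex \<Rightarrow> real \<Rightarrow> complex" where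
  "f_zz f \<zeta> u = deriv (\<lambda>z. f_z f z u) \<zeta>"

definition pp_metric :: "(complex \<Rightarrow> real \<Rightarrow> complex) \<Rightarrow> point \<Rightarrow> point \<Rightarrow> complex" where
  "pp_metric f = (\<lambda>(\<zeta>, u, v) (d\<zeta>, du, dv).
     2 * d\<zeta> * cnj d\<zeta> - 2 * of_real du * of_real dv
       - 2 * (f \<zeta> u + cnj (f \<zeta> u)) * (of_real du)^2)"

definition zu_proj :: "point set \<Rightarrow> (complex \<times> real) set" where
  "zu_proj U = {(\<zeta>, u). \<exists>v. (\<zeta>, u, v) \<in> U}"

text \<open>The function \<open>f\<close> defines a (non-flat) vacuum pp-wave on the coordinate domain \<open>U\<close>.\<close>

definition vacuum_pp_wave :: "point set \<Rightarrow> (complex \<Rightarrow> real \<Rightarrow> complex) \<Rightarrow> bool" where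
  "vacuum_pp_wave U f \<longleftrightarrow>
     open U \<and> connected U \<and> U \<noteq> {} \<and>
     smooth_on (zu_proj U) (\<lambda>(\<zeta>, u). f \<zeta> u) \<and>
     (\<forall>(\<zeta>, u) \<in> zu_proj U. (\<lambda>z. f z u) analytic_on {\<zeta>} \<and> f_zz f \<zeta> u \<noteq> 0)"

text \<open>
  A choice of \<open>a\<close>, \<open>Z\<close> and \<open>L\<close> on \<open>U\<close>: continuous branches of \<open>a = log f\<^sub>\<zeta>\<^sub>\<zeta> / 4\<close> and
  \<open>L = log Z\<^sub>a\<close>, where \<open>\<zeta> = Z(a, u)\<close> inverts \<open>a = a(\<zeta>, u)\<close> at fixed \<open>u\<close>.  That these exist on
  all of \<open>U\<close> is what it means for the domain to be small.  \<open>Z\<close> and \<open>L\<close> only matter on the image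
  of \<open>(\<zeta>, u) \<mapsto> (a(\<zeta>, u), u)\<close>, which is open, so the derivatives used below are determined.
\<close>

definition adapted_functions ::
  "point set \<Rightarrow> (complex \<Rightarrow> real \<Rightarrow> complex) \<Rightarrow> (complex \<Rightarrow> real \<Rightarrow> complex)
     \<Rightarrow> (complex \<Rightarrow> real \<Rightarrow> complex) \<Rightarrow> (complex \<Rightarrow> real \<Rightarrow> complex) \<Rightarrow> bool" where
  "adapted_functions U f a Z L \<longleftrightarrow>
     continuous_on (zu_proj U) (\<lambda>(\<zeta>, u). a \<zeta> u) \<and>
     (\<forall>(\<zeta>, u) \<in> zu_proj U. exp (4 * a \<zeta> u) = f_zz f \<zeta> u) \<and>
     (\<forall>(\<zeta>, u) \<in> zu_proj U. Z (a \<zeta> u) u = \<zeta>) \<and>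
     continuous_on ((\<lambda>(\<zeta>, u). (a \<zeta> u, u)) ` zu_proj U) (\<lambda>(b, u). L b u) \<and>
     (\<forall>(\<zeta>, u) \<in> zu_proj U. exp (L (a \<zeta> u) u) = deriv (\<lambda>b. Z b u) (a \<zeta> u))"

text \<open>Derivative with respect to \<open>u\<close> with \<open>a\<close> held fixed, for functions of \<open>(a, u)\<close>.\<close>

definition du_fixed :: "(complex \<Rightarrow> real \<Rightarrow> complex) \<Rightarrow> complex \<Rightarrow> real \<Rightarrow> complex" where
  "du_fixed F b u = vector_derivative (\<lambda>s. F b s) (at u)"

definition Z_u :: "(complex \<Rightarrow> real \<Rightarrow> complex) \<Rightarrow> (complex \<Rightarrow> real \<Rightarrow> complex) \<Rightarrow> complex \<Rightarrow> real \<Rightarrow> complex" where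
  "Z_u a Z \<zeta> u = du_fixed Z (a \<zeta> u) u"

definition Z_uu :: "(complex \<Rightarrow> real \<Rightarrow> complex) \<Rightarrow> (complex \<Rightarrow> real \<Rightarrow> complex) \<Rightarrow> complex \<Rightarrow> real \<Rightarrow> complex" where
  "Z_uu a Z \<zeta> u = du_fixed (du_fixed Z) (a \<zeta> u) u"


section \<open>Normalized coframe and its dual null tetrad\<close>

definition omega1 :: "(complex \<Rightarrow> real \<Rightarrow> complex) \<Rightarrow> (complex \<Rightarrow> real \<Rightarrow> complex) \<Rightarrow> point \<Rightarrow> point \<Rightarrow> complex" where
  "omega1 a Z = (\<lambda>(\<zeta>, u, v) (d\<zeta>, du, dv).
     exp (a \<zeta> u - cnj (a \<zeta> u)) * (d\<zeta> - Z_u a Z \<zeta> u * of_real du))"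

definition omega2 :: "(complex \<Rightarrow> real \<Rightarrow> complex) \<Rightarrow> (complex \<Rightarrow> real \<Rightarrow> complex) \<Rightarrow> point \<Rightarrow> point \<Rightarrow> complex" where
  "omega2 a Z p X = cnj (omega1 a Z p X)"

definition omega3 :: "(complex \<Rightarrow> real \<Rightarrow> complex) \<Rightarrow> point \<Rightarrow> point \<Rightarrow> complex" where
  "omega3 a = (\<lambda>(\<zeta>, u, v) (d\<zeta>, du, dv). exp (a \<zeta> u + cnj (a \<zeta> u)) * of_real du)"

definition omega4 :: "(complex \<Rightarrow> real \<Rightarrow> complex) \<Rightarrow> (complex \<Rightarrow> real \<Rightarrow> complex) \<Rightarrow> (complex \<Rightarrow> real \<Rightarrow> complex)
    \<Rightarrow> point \<Rightarrow> point \<Rightarrow> complex" where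
  "omega4 f a Z = (\<lambda>(\<zeta>, u, v) (d\<zeta>, du, dv).
     exp (- a \<zeta> u - cnj (a \<zeta> u)) *
       ((f \<zeta> u + cnj (f \<zeta> u) + Z_u a Z \<zeta> u * cnj (Z_u a Z \<zeta> u)) * of_real du + of_real dv
         - Z_u a Z \<zeta> u * cnj d\<zeta> - cnj (Z_u a Z \<zeta> u) * d\<zeta>))"

text \<open>
  The dual frame as first-order differential operators in the coordinates; duality is the
  lemma \<open>dual_tetrad\<close> below.  On functions of \<open>(a, a\<^sup>*, u)\<close> the chain rule gives
  \<open>\<delta>Q = \<alpha>\<^sup>* Q\<^sub>a\<close>, \<open>\<delta>\<^sup>*Q = \<alpha> Q\<^sub>a\<^sub>*\<close>, \<open>\<Delta>Q = exp(-a-a\<^sup>*) Q\<^sub>u\<close> and \<open>DQ = 0\<close>.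
\<close>

definition np_delta :: "(complex \<Rightarrow> real \<Rightarrow> complex) \<Rightarrow> (complex \<Rightarrow> real \<Rightarrow> complex)
    \<Rightarrow> (point \<Rightarrow> complex) \<Rightarrow> point \<Rightarrow> complex" where
  "np_delta a Z Q = (\<lambda>(\<zeta>, u, v).
     exp (cnj (a \<zeta> u) - a \<zeta> u) *
       (d_zeta Q (\<zeta>, u, v) + cnj (Z_u a Z \<zeta> u) * d_v Q (\<zeta>, u, v)))"

definition np_delta_star :: "(complex \<Rightarrow> real \<Rightarrow> complex) \<Rightarrow> (complex \<Rightarrow> real \<Rightarrow> complex)
    \<Rightarrow> (point \<Rightarrow> complex) \<Rightarrow> point \<Rightarrow> complex" where
  "np_delta_star a Z Q = (\<lambda>(\<zeta>, u, v).
     exp (a \<zeta> u - cnj (a \<zeta> u)) *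
       (d_zeta_bar Q (\<zeta>, u, v) + Z_u a Z \<zeta> u * d_v Q (\<zeta>, u, v)))"

definition np_Delta :: "(complex \<Rightarrow> real \<Rightarrow> complex) \<Rightarrow> (complex \<Rightarrow> real \<Rightarrow> complex) \<Rightarrow> (complex \<Rightarrow> real \<Rightarrow> complex)
    \<Rightarrow> (point \<Rightarrow> complex) \<Rightarrow> point \<Rightarrow> complex" where
  "np_Delta f a Z Q = (\<lambda>(\<zeta>, u, v).
     exp (- a \<zeta> u - cnj (a \<zeta> u)) *
       (d_u Q (\<zeta>, u, v) + Z_u a Z \<zeta> u * d_zeta Q (\<zeta>, u, v)
         + cnj (Z_u a Z \<zeta> u) * d_zeta_bar Q (\<zeta>, u, v)
         + (Z_u a Z \<zeta> u * cnj (Z_u a Z \<zeta> u) - f \<zeta> u - cnj (f \<zeta> u)) * d_v Q (\<zeta>, u, v)))"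

definition np_D :: "(complex \<Rightarrow> real \<Rightarrow> complex) \<Rightarrow> (point \<Rightarrow> complex) \<Rightarrow> point \<Rightarrow> complex" where
  "np_D a Q = (\<lambda>(\<zeta>, u, v). exp (a \<zeta> u + cnj (a \<zeta> u)) * d_v Q (\<zeta>, u, v))"

lemma pp_metric_coframe:
  "pp_metric f p X = 2 * omega1 a Z p X * omega2 a Z p X - 2 * omega3 a p X * omega4 f a Z p X"
proof -
  obtain z u v where p: "p = (z, u, v)" by (cases p)
  obtain dz du dv where X: "X = (dz, du, dv)" by (cases X)
  let ?b = "a z u" and ?w = "Z_u a Z z u"
  have 1: "exp (?b - cnj ?b) * exp (cnj ?b - ?b) = 1"
    and 2: "exp (?b + cnj ?b) * exp (- ?b - cnj ?b) = 1"
    by (simp_all flip: exp_add)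
  have "omega1 a Z p X * omega2 a Z p X
      = (exp (?b - cnj ?b) * exp (cnj ?b - ?b))
        * ((dz - ?w * of_real du) * (cnj dz - cnj ?w * of_real du))"
    by (simp add: p X omega1_def omega2_def exp_cnj)
  moreover have "omega3 a p X * omega4 f a Z p X
      = (exp (?b + cnj ?b) * exp (- ?b - cnj ?b)) * (of_real du *
       ((f z u + cnj (f z u) + ?w * cnj ?w) * of_real du + of_real dv - ?w * cnj dz - cnj ?w * dz))"
    by (simp add: p X omega3_def omega4_def mult_ac)
  ultimately show ?thesis
    by (simp add: 1 2 p X pp_metric_def power2_eq_square mult.assoc) (simp add: algebra_simps)
qed

lemma dual_tetrad:
  assumes "Q differentiable (at p)"
  shows "ext_d Q p X =
    omega1 a Z p X * np_delta a Z Q p + omega2 a Z p X * np_delta_star a Z Q p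
      + omega3 a p X * np_Delta f a Z Q p + omega4 f a Z p X * np_D a Q p"
proof -
  obtain z u v where p: "p = (z, u, v)" by (cases p)
  obtain dz du dv where X: "X = (dz, du, dv)" by (cases X)
  let ?b = "a z u" and ?w = "Z_u a Z z u"
  have lin: "linear (ext_d Q p)"
    using assms unfolding ext_d_def by (rule linear_frechet_derivative)
  have "X = Re dz *\<^sub>R (1, 0, 0) + Im dz *\<^sub>R (\<i>, 0, 0) + du *\<^sub>R (0, 1, 0) + dv *\<^sub>R (0, 0, 1)"
    by (simp add: X complex_eq_iff)
  then have "ext_d Q p X = Re dz *\<^sub>R ext_d Q p (1, 0, 0) + Im dz *\<^sub>R ext_d Q p (\<i>, 0, 0)
      + du *\<^sub>R d_u Q p + dv *\<^sub>R d_v Q p"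
    by (simp only: linear_add[OF lin] linear_scale[OF lin] d_u_def d_v_def)
  also have "\<dots> = dz * d_zeta Q p + cnj dz * d_zeta_bar Q p + of_real du * d_u Q p + of_real dv * d_v Q p"
    by (simp add: d_zeta_def d_zeta_bar_def scaleR_conv_of_real complex_eq_iff field_simps)
  finally have E: "ext_d Q p X =
    dz * d_zeta Q p + cnj dz * d_zeta_bar Q p + of_real du * d_u Q p + of_real dv * d_v Q p" .
  have 1: "exp (?b - cnj ?b) * exp (cnj ?b - ?b) = 1"
    and 2: "exp (?b + cnj ?b) * exp (- ?b - cnj ?b) = 1"
    by (simp_all flip: exp_add)
  have "omega1 a Z p X * np_delta a Z Q p = (exp (?b - cnj ?b) * exp (cnj ?b - ?b))
      * ((dz - ?w * of_real du) * (d_zeta Q p + cnj ?w * d_v Q p))"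
    by (simp add: p X omega1_def np_delta_def)
  moreover have "omega2 a Z p X * np_delta_star a Z Q p = (exp (?b - cnj ?b) * exp (cnj ?b - ?b))
      * ((cnj dz - cnj ?w * of_real du) * (d_zeta_bar Q p + ?w * d_v Q p))"
    by (simp add: p X omega1_def omega2_def np_delta_star_def exp_cnj)
  moreover have "omega3 a p X * np_Delta f a Z Q p = (exp (?b + cnj ?b) * exp (- ?b - cnj ?b))
      * (of_real du * (d_u Q p + ?w * d_zeta Q p + cnj ?w * d_zeta_bar Q p
          + (?w * cnj ?w - f z u - cnj (f z u)) * d_v Q p))"
    by (simp add: p X omega3_def np_Delta_def)
  moreover have "omega4 f a Z p X * np_D a Q p = (exp (?b + cnj ?b) * exp (- ?b - cnj ?b))
      * (((f z u + cnj (f z u) + ?w * cnj ?w) * of_real du + of_real dv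
          - ?w * cnj dz - cnj ?w * dz) * d_v Q p)"
    by (simp add: p X omega4_def np_D_def)
  ultimately show ?thesis
    unfolding E by (simp only: 1 2) (simp add: algebra_simps)
qed


section \<open>Spin coefficients and invariants\<close>

definition np_alpha :: "(complex \<Rightarrow> real \<Rightarrow> complex) \<Rightarrow> point \<Rightarrow> complex" where
  "np_alpha a = (\<lambda>(\<zeta>, u, v). exp (a \<zeta> u - cnj (a \<zeta> u)) * cnj (deriv (\<lambda>z. a z u) \<zeta>))"

definition np_mu :: "(complex \<Rightarrow> real \<Rightarrow> complex) \<Rightarrow> (complex \<Rightarrow> real \<Rightarrow> complex) \<Rightarrow> point \<Rightarrow> complex" where
  "np_mu a L = (\<lambda>(\<zeta>, u, v). exp (- a \<zeta> u - cnj (a \<zeta> u)) * du_fixed L (a \<zeta> u) u)"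

definition np_nu :: "(complex \<Rightarrow> real \<Rightarrow> complex) \<Rightarrow> (complex \<Rightarrow> real \<Rightarrow> complex) \<Rightarrow> (complex \<Rightarrow> real \<Rightarrow> complex)
    \<Rightarrow> point \<Rightarrow> complex" where
  "np_nu f a Z = (\<lambda>(\<zeta>, u, v).
     exp (- a \<zeta> u - 3 * cnj (a \<zeta> u)) * (Z_uu a Z \<zeta> u + cnj (f_z f \<zeta> u)))"

definition inv_A :: "(complex \<Rightarrow> real \<Rightarrow> complex) \<Rightarrow> (complex \<Rightarrow> real \<Rightarrow> complex) \<Rightarrow> point \<Rightarrow> complex" where
  "inv_A a Z p = np_delta_star a Z (np_alpha a) p / (np_alpha a p)^2"

definition inv_Y :: "(complex \<Rightarrow> real \<Rightarrow> complex) \<Rightarrow> (complex \<Rightarrow> real \<Rightarrow> complex) \<Rightarrow> (complex \<Rightarrow> real \<Rightarrow> complex)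
    \<Rightarrow> (complex \<Rightarrow> real \<Rightarrow> complex) \<Rightarrow> point \<Rightarrow> complex" where
  "inv_Y f a Z L p =
     (3 - inv_A a Z p) * np_nu f a Z p - 1 / np_alpha a p
       + (np_Delta f a Z (np_mu a L) p + (np_mu a L p)^2) / cnj (np_alpha a p)"


section \<open>The class \<open>AP\<^sub>1\<^sub>3\<close>\<close>

text \<open>
  \<open>lg\<close> is a branch of \<open>log (k\<^sub>0 \<zeta>)\<close> on the \<open>\<zeta>\<close>-projection of the domain; it fixes the branch of
  the power \<open>(k\<^sub>0 \<zeta>)\<^sup>c = exp (c log (k\<^sub>0 \<zeta>))\<close>.  Its existence forces \<open>\<zeta> \<noteq> 0\<close> on the domain.
\<close>

definition log_branch :: "point set \<Rightarrow> real \<Rightarrow> (complex \<Rightarrow> complex) \<Rightarrow> bool" where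
  "log_branch U k0 lg \<longleftrightarrow>
     continuous_on (fst ` U) lg \<and> (\<forall>\<zeta> \<in> fst ` U. exp (lg \<zeta>) = of_real k0 * \<zeta>)"

definition AP13 :: "real \<Rightarrow> (complex \<Rightarrow> complex) \<Rightarrow> (real \<Rightarrow> complex) \<Rightarrow> complex \<Rightarrow> real \<Rightarrow> complex" where
  "AP13 k1 lg g \<zeta> u = exp (2 * \<i> * of_real k1 * lg \<zeta>) + g u * \<zeta>"

end

theory Submission
  imports Defs
begin

text \<open>
  Write \<open>c = 2ik\<^sub>1\<close> and \<open>m = (c - 2)/4\<close>.  Since \<open>f\<^sub>\<zeta>\<^sub>\<zeta>\<close> is independent of \<open>u\<close>, connectedness of the
  domain gives \<open>a = m log (k\<^sub>0 \<zeta>) + K\<close> with a constant \<open>K\<close>; hence \<open>Z\<close> and \<open>L\<close> are independent of \<open>u\<close>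
  at fixed \<open>a\<close>, and \<open>Z\<^sub>u = Z\<^sub>u\<^sub>u = \<mu> = 0\<close>.  Then \<open>A = -(m\<^sup>* + 1)/m\<^sup>*\<close> is constant and
  \<open>\<nu> = m\<^sup>*/((c\<^sup>* - 1) \<alpha>) + N\<close> with \<open>N = exp(-a-3a\<^sup>*) g\<^sup>*\<close>, so that \<open>Y = (c\<^sup>* - 1) N / m\<^sup>*\<close> and
  \<open>d\<alpha> \<and> d\<nu> = d\<alpha> \<and> dN\<close>, whose \<open>(\<zeta>, \<zeta>\<^sup>*)\<close> component is \<open>-m (c\<^sup>* - 1) \<alpha> N / |\<zeta>|\<^sup>2\<close>.
\<close>

section \<open>Branches of logarithms, projections and derivatives at fixed \<open>a\<close>\<close>

text \<open>Distinct complex numbers with the same exponential are at least 2 pi apart, so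
  \<open>h\<close> has discrete range and connectedness forces a single value. This pins down
  logarithms known only through their exponentials.\<close>

lemma constant_on_if_exp_constant:
  fixes h :: "'a::topological_space \<Rightarrow> complex"
  assumes "connected S" "continuous_on S h" "\<And>x. x \<in> S \<Longrightarrow> exp (h x) = w"
  shows "h constant_on S"
proof (rule continuous_discrete_range_constant[OF assms(1,2)])
  fix x assume x: "x \<in> S"
  have "2 * pi \<le> norm (h y - h x)" if y: "y \<in> S" "h y \<noteq> h x" for y
  proof -
    have "\<not> \<bar>Im (h y) - Im (h x)\<bar> < 2 * pi"
      using exp_complex_eqI[of "h y" "h x"] assms(3)[OF x] assms(3)[OF y(1)] y(2) by auto
    then show ?thesis
      using abs_Im_le_cmod[of "h y - h x"] by simp
  qed
  then show "\<exists>e>0. \<forall>y. y \<in> S \<and> h y \<noteq> h x \<longrightarrow> e \<le> norm (h y - h x)"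
    by (intro exI[of _ "2 * pi"]) auto
qed

lemma has_derivative_exp_complex:
  fixes h :: "'a::real_normed_vector \<Rightarrow> complex"
  assumes "(h has_derivative h') (at x)"
  shows "((\<lambda>y. exp (h y)) has_derivative (\<lambda>X. exp (h x) * h' X)) (at x)"
  using has_derivative_compose[OF assms DERIV_exp[of "h x", unfolded has_field_derivative_def]] .

lemma zu_proj_eq_image: "zu_proj U = (\<lambda>(\<zeta>, u, v). (\<zeta>, u)) ` U"
  by (force simp: zu_proj_def)

lemma open_zu_proj:
  assumes "open U" shows "open (zu_proj U)"
proof -
  have "linear (\<lambda>p::point. (fst p, fst (snd p)))"
    by (intro linearI) auto
  moreover have "surj (\<lambda>p::point. (fst p, fst (snd p)))"
    by (rule surjI[of _ "\<lambda>(z, u). (z, u, 0)"]) auto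
  ultimately have "open ((\<lambda>p::point. (fst p, fst (snd p))) ` U)"
    using assms open_surjective_linear_image by blast
  then show ?thesis
    by (simp add: zu_proj_eq_image case_prod_beta)
qed

lemma connected_zu_proj:
  assumes "connected U" shows "connected (zu_proj U)"
  unfolding zu_proj_eq_image case_prod_beta
  by (intro connected_continuous_image assms continuous_intros)

text \<open>The slice of the open set \<open>T\<close> through \<open>b\<close> is a neighbourhood
  of \<open>u\<close>, and the derivative depends on the values there only.\<close>

lemma du_fixed_eq_0:
  assumes "open T" "(b, u) \<in> T" "\<And>s. (b, s) \<in> T \<Longrightarrow> F b s = F b u"
  shows "du_fixed F b u = 0"
proof -
  have "open (Pair b -` T)"
    by (intro open_vimage assms(1) continuous_on_Pair continuous_on_const continuous_on_id)
  then have "((\<lambda>s. F b s) has_vector_derivative 0) (at u)"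
    by (rule has_vector_derivative_transform_within_open[OF has_vector_derivative_const])
       (use assms(2) in \<open>auto intro: assms(3)[symmetric]\<close>)
  then show ?thesis
    unfolding du_fixed_def by (rule vector_derivative_at)
qed

section \<open>The wave and its exponents\<close>

locale AP13_wave =
  fixes U :: "point set" and k0 k1 :: real and lg :: "complex \<Rightarrow> complex" and g :: "real \<Rightarrow> complex"
    and f a Z L :: "complex \<Rightarrow> real \<Rightarrow> complex"
  assumes k0: "k0 \<noteq> 0" and k1: "k1 \<noteq> 0"
    and log_branch: "log_branch U k0 lg"
    and f_eq: "f = AP13 k1 lg g"
    and wave: "vacuum_pp_wave U f"
    and adapted: "adapted_functions U f a Z L"
begin

definition c :: complex where "c = 2 * \<i> * of_real k1"
definition m :: complex where "m = (c - 2) / 4"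

text \<open>\<open>c\<close> is nonzero and purely imaginary. That \<open>c\<close> differs from 2
  means \<open>m\<close> is nonzero; \<open>c - 1\<close> is the factor that links \<open>Y\<close>
  and the wedge product to \<open>g\<close>.\<close>

lemma c_neq: "c \<noteq> 0" "c \<noteq> 1" "c \<noteq> 2"
  using k1 by (auto simp: c_def complex_eq_iff)

lemma m_neq_0: "m \<noteq> 0"
  using c_neq by (simp add: m_def)

lemma open_U: "open U" and connected_U: "connected U"
  using wave by (auto simp: vacuum_pp_wave_def)

lemma open_zu: "open (zu_proj U)" and connected_zu: "connected (zu_proj U)"
  using open_zu_proj[OF open_U] connected_zu_proj[OF connected_U] .

lemma open_fst_U: "open (fst ` U)"
  using open_U by (rule open_image_fst)

lemma zu_projD: "(\<zeta>, u) \<in> zu_proj U \<Longrightarrow> \<zeta> \<in> fst ` U"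
  by (force simp: zu_proj_def)

lemma zu_projI: "(\<zeta>, u, v) \<in> U \<Longrightarrow> (\<zeta>, u) \<in> zu_proj U"
  by (auto simp: zu_proj_def)

lemma exp_lg: "\<zeta> \<in> fst ` U \<Longrightarrow> exp (lg \<zeta>) = of_real k0 * \<zeta>"
  using log_branch by (auto simp: log_branch_def)

lemma zeta_neq_0: "\<zeta> \<in> fst ` U \<Longrightarrow> \<zeta> \<noteq> 0"
  using exp_lg[of \<zeta>] by auto

lemma continuous_on_lg: "continuous_on (fst ` U) lg"
  using log_branch by (simp add: log_branch_def)

section \<open>Derivatives of \<open>f\<close> and the form of \<open>a\<close>\<close>

text \<open>\<open>lg\<close> is a continuous inverse of \<open>exp w / k0\<close>, whose derivative
  at \<open>lg \<zeta>\<close> is \<zeta> itself, nonzero on the domain.\<close>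

lemma DERIV_lg:
  assumes "\<zeta> \<in> fst ` U"
  shows "(lg has_field_derivative 1 / \<zeta>) (at \<zeta>)"
proof -
  have "((\<lambda>w. exp w / of_real k0) has_field_derivative \<zeta>) (at (lg \<zeta>))"
    by (rule derivative_eq_intros refl)+ (use k0 exp_lg[OF assms] in auto)
  then have "(lg has_field_derivative inverse \<zeta>) (at \<zeta>)"
    using zeta_neq_0[OF assms] continuous_on_lg open_fst_U assms exp_lg k0
    by (elim has_field_derivative_inverse_basic[where t = "fst ` U"])
       (auto simp: continuous_on_eq_continuous_at)
  then show ?thesis
    by (simp add: inverse_eq_divide)
qed

lemma f_z_eq:
  assumes "\<zeta> \<in> fst ` U"
  shows "f_z f \<zeta> u = c * exp (c * lg \<zeta>) / \<zeta> + g u"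
  unfolding f_z_def f_eq AP13_def
  by (rule DERIV_imp_deriv, (rule derivative_eq_intros DERIV_lg assms refl)+)
     (simp add: c_def)

lemma f_zz_eq:
  assumes "\<zeta> \<in> fst ` U"
  shows "f_zz f \<zeta> u = c * (c - 1) * exp (c * lg \<zeta>) / \<zeta>\<^sup>2"
proof -
  have "((\<lambda>z. c * exp (c * lg z) / z + g u) has_field_derivative
      c * (c - 1) * exp (c * lg \<zeta>) / \<zeta>\<^sup>2) (at \<zeta>)"
    by (rule derivative_eq_intros DERIV_lg assms zeta_neq_0[OF assms] refl)+
       (use zeta_neq_0[OF assms] in \<open>auto simp: field_simps power2_eq_square\<close>)
  then have "((\<lambda>z. f_z f z u) has_field_derivative
      c * (c - 1) * exp (c * lg \<zeta>) / \<zeta>\<^sup>2) (at \<zeta>)"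
    by (rule has_field_derivative_transform_within_open[OF _ open_fst_U assms]) (simp add: f_z_eq)
  then show ?thesis
    unfolding f_zz_def by (rule DERIV_imp_deriv)
qed

lemma exp_4a:
  assumes "(\<zeta>, u) \<in> zu_proj U"
  shows "exp (4 * a \<zeta> u) = c * (c - 1) * exp (c * lg \<zeta>) / \<zeta>\<^sup>2"
  using adapted assms f_zz_eq[OF zu_projD[OF assms]] by (auto simp: adapted_functions_def)

lemma continuous_on_a: "continuous_on (zu_proj U) (\<lambda>(\<zeta>, u). a \<zeta> u)"
  using adapted by (simp add: adapted_functions_def)

lemma Z_a: "(\<zeta>, u) \<in> zu_proj U \<Longrightarrow> Z (a \<zeta> u) u = \<zeta>"
  using adapted by (auto simp: adapted_functions_def)

lemma ex_K: "\<exists>K. \<forall>(\<zeta>, u) \<in> zu_proj U. a \<zeta> u = m * lg \<zeta> + K"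
proof -
  \<comment> \<open>The factor 4 is there because \<open>a\<close> is known only through
    \<open>exp (4 * a)\<close>; since \<open>4 * m = c - 2\<close>, the powers of \<zeta> cancel in
    \<open>exp ?h\<close>.\<close>
  let ?h = "\<lambda>p. 4 * (a (fst p) (snd p) - m * lg (fst p))"
  have "continuous_on (zu_proj U) (\<lambda>p. lg (fst p))"
    by (rule continuous_on_compose2[OF continuous_on_lg]) (auto intro: continuous_intros dest: zu_projD)
  then have "continuous_on (zu_proj U) ?h"
    using continuous_on_a by (auto simp: case_prod_beta intro!: continuous_intros)
  moreover have "exp (?h p) = c * (c - 1) * (of_real k0)\<^sup>2" if p: "p \<in> zu_proj U" for p
  proof -
    obtain \<zeta> u where pe: "p = (\<zeta>, u)" by (cases p)
    have \<zeta>: "\<zeta> \<in> fst ` U" using p pe zu_projD by auto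
    have "?h p = 4 * a \<zeta> u - c * lg \<zeta> + (lg \<zeta> + lg \<zeta>)"
      by (simp add: pe m_def field_simps)
    then have "exp (?h p) = exp (4 * a \<zeta> u) / exp (c * lg \<zeta>) * (exp (lg \<zeta>))\<^sup>2"
      by (simp only: exp_add exp_diff power2_eq_square)
    also have "\<dots> = c * (c - 1) * (of_real k0)\<^sup>2"
      using zeta_neq_0[OF \<zeta>] p by (simp add: pe exp_4a exp_lg[OF \<zeta>] power_mult_distrib)
    finally show ?thesis .
  qed
  ultimately have "?h constant_on zu_proj U"
    by (rule constant_on_if_exp_constant[OF connected_zu])
  then obtain K where "\<forall>p\<in>zu_proj U. ?h p = K"
    unfolding constant_on_def by blast
  then have "\<forall>(\<zeta>, u) \<in> zu_proj U. a \<zeta> u = m * lg \<zeta> + K / 4"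
    by (auto simp: field_simps)
  then show ?thesis ..
qed

definition K :: complex where "K = (SOME K. \<forall>(\<zeta>, u) \<in> zu_proj U. a \<zeta> u = m * lg \<zeta> + K)"

lemma a_eq: "(\<zeta>, u) \<in> zu_proj U \<Longrightarrow> a \<zeta> u = m * lg \<zeta> + K"
  using someI_ex[OF ex_K] unfolding K_def by blast

section \<open>The functions \<open>Z\<close>, \<open>L\<close> and the vanishing of \<mu>\<close>

definition S :: "(complex \<times> real) set" where "S = (\<lambda>(\<zeta>, u). (a \<zeta> u, u)) ` zu_proj U"

lemma in_S: "(\<zeta>, u) \<in> zu_proj U \<Longrightarrow> (a \<zeta> u, u) \<in> S"
  by (force simp: S_def)

text \<open>Invariance of domain applies: the map is continuous, and injective because
  \<open>Z\<close> recovers \<zeta> from \<open>a\<close> and \<open>u\<close>. Derivatives at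
  points of \<open>S\<close> are thereby determined by values on \<open>S\<close>.\<close>

lemma open_S: "open S"
  unfolding S_def
proof (rule invariance_of_domain[OF _ open_zu])
  show "continuous_on (zu_proj U) (\<lambda>(\<zeta>, u). (a \<zeta> u, u))"
    using continuous_on_a by (auto simp: case_prod_beta intro!: continuous_intros)
  show "inj_on (\<lambda>(\<zeta>, u). (a \<zeta> u, u)) (zu_proj U)"
    by (auto simp: inj_on_def) (metis Z_a)
qed

text \<open>Solve \<open>a = m * lg \<zeta> + K\<close> for \<open>lg \<zeta>\<close> and
  exponentiate. The right-hand side is free of \<open>u\<close>, which gives the vanishing of
  \<open>Z_u\<close> and \<open>Z_uu\<close>.\<close>

lemma Z_eq:
  assumes "(b, u) \<in> S"
  shows "Z b u = exp ((b - K) / m) / of_real k0"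
proof -
  obtain \<zeta> where \<zeta>: "(\<zeta>, u) \<in> zu_proj U" "b = a \<zeta> u"
    using assms by (auto simp: S_def)
  then show ?thesis
    using m_neq_0 k0 Z_a[OF \<zeta>(1)] by (simp add: a_eq[OF \<zeta>(1)] exp_lg[OF zu_projD[OF \<zeta>(1)]])
qed

lemma du_fixed_Z: "(b, u) \<in> S \<Longrightarrow> du_fixed Z b u = 0"
  by (rule du_fixed_eq_0[OF open_S]) (auto simp: Z_eq)

lemma Z_u_eq_0: "(\<zeta>, u) \<in> zu_proj U \<Longrightarrow> Z_u a Z \<zeta> u = 0"
  by (simp add: Z_u_def du_fixed_Z in_S)

lemma Z_uu_eq_0: "(\<zeta>, u) \<in> zu_proj U \<Longrightarrow> Z_uu a Z \<zeta> u = 0"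
  unfolding Z_uu_def by (rule du_fixed_eq_0[OF open_S]) (auto simp: du_fixed_Z in_S)

lemma exp_L:
  assumes "(b, u) \<in> S"
  shows "exp (L b u) = exp ((b - K) / m) / (of_real k0 * m)"
proof -
  obtain \<zeta> where "(\<zeta>, u) \<in> zu_proj U" "b = a \<zeta> u"
    using assms by (auto simp: S_def)
  then have "exp (L b u) = deriv (\<lambda>b. Z b u) b"
    using adapted by (auto simp: adapted_functions_def)
  moreover have "((\<lambda>b. Z b u) has_field_derivative exp ((b - K) / m) / (of_real k0 * m)) (at b)"
  proof (rule has_field_derivative_transform_within_open)
    show "((\<lambda>b. exp ((b - K) / m) / of_real k0) has_field_derivative
        exp ((b - K) / m) / (of_real k0 * m)) (at b)"
      using DERIV_cdivide[of "\<lambda>b. exp ((b - K) / m)" "exp ((b - K) / m) / m" b UNIV "of_real k0"]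
      by (auto intro!: derivative_eq_intros simp: m_neq_0 k0 mult.commute)
    show "open ((\<lambda>b. (b, u)) -` S)"
      by (intro open_vimage open_S continuous_on_Pair continuous_on_const continuous_on_id)
  qed (use assms in \<open>auto simp: Z_eq\<close>)
  ultimately show ?thesis
    by (simp add: DERIV_imp_deriv)
qed

text \<open>At fixed \<open>b\<close> the exponential of \<open>L\<close> does not depend on
  \<open>u\<close>, which determines \<open>L\<close> up to multiples of 2 pi i; continuity on an
  interval around \<open>u\<close> removes this ambiguity. The interval is used because the slice of
  \<open>S\<close> through \<open>b\<close> need not be connected.\<close>

lemma du_fixed_L:
  assumes "(b, u) \<in> S"
  shows "du_fixed L b u = 0"
proof -
  obtain B V where BV: "open B" "open V" "b \<in> B" "u \<in> V" "B \<times> V \<subseteq> S"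
    using open_prod_elim[OF open_S assms] by (metis mem_Sigma_iff)
  obtain e where e: "e > 0" "ball u e \<subseteq> V"
    using BV open_contains_ball by blast
  have sub: "(b, s) \<in> S" if "s \<in> ball u e" for s
    using that e BV by blast
  have "continuous_on S (\<lambda>(b, u). L b u)"
    using adapted by (simp add: adapted_functions_def S_def)
  then have "continuous_on (ball u e) (\<lambda>s. (\<lambda>(b, u). L b u) (b, s))"
    by (rule continuous_on_compose2) (auto intro: continuous_intros sub)
  then have "(\<lambda>s. L b s) constant_on ball u e"
    by (intro constant_on_if_exp_constant) (auto simp: exp_L sub)
  then obtain w where "\<forall>s\<in>ball u e. L b s = w"
    unfolding constant_on_def by blast
  \<comment> \<open>The first factor of \<open>T\<close> is arbitrary, as only the slice through
    \<open>b\<close> matters.\<close>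
  then show ?thesis
    using e by (intro du_fixed_eq_0[where T = "UNIV \<times> ball u e"]) (auto intro!: open_Times)
qed

lemma mu_eq_0: "p \<in> U \<Longrightarrow> np_mu a L p = 0"
  by (cases p) (auto simp: np_mu_def du_fixed_L in_S zu_projI)

lemma Delta_mu_eq_0:
  assumes "p \<in> U"
  shows "np_Delta f a Z (np_mu a L) p = 0"
proof -
  have "(np_mu a L has_derivative (\<lambda>_. 0)) (at p)"
    by (rule has_derivative_transform_within_open[OF has_derivative_const open_U assms, of 0])
       (simp add: mu_eq_0)
  then have "ext_d (np_mu a L) p = (\<lambda>_. 0)"
    unfolding ext_d_def by (metis frechet_derivative_at)
  then show ?thesis
    by (cases p) (simp add: np_Delta_def d_u_def d_v_def d_zeta_def d_zeta_bar_def)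
qed

section \<open>The spin coefficient \<alpha> and the invariant \<open>A\<close>\<close>

lemma deriv_a:
  assumes "(\<zeta>, u) \<in> zu_proj U"
  shows "deriv (\<lambda>z. a z u) \<zeta> = m / \<zeta>"
proof (rule DERIV_imp_deriv)
  have "open ((\<lambda>z. (z, u)) -` zu_proj U)"
    by (intro open_vimage open_zu continuous_intros)
  moreover have "((\<lambda>z. m * lg z + K) has_field_derivative m / \<zeta>) (at \<zeta>)"
    by (rule derivative_eq_intros DERIV_lg zu_projD[OF assms] refl)+ simp
  ultimately show "((\<lambda>z. a z u) has_field_derivative m / \<zeta>) (at \<zeta>)"
    using assms by (elim has_field_derivative_transform_within_open) (auto simp: a_eq)
qed

lemma alpha_eq:
  assumes "(\<zeta>, u, v) \<in> U"
  shows "np_alpha a (\<zeta>, u, v) = exp (a \<zeta> u - cnj (a \<zeta> u)) * cnj (m / \<zeta>)"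
  by (simp add: np_alpha_def deriv_a[OF zu_projI[OF assms]])

lemma alpha_neq_0: "(\<zeta>, u, v) \<in> U \<Longrightarrow> np_alpha a (\<zeta>, u, v) \<noteq> 0"
  using zeta_neq_0[OF zu_projD[OF zu_projI]] m_neq_0 by (simp add: alpha_eq)

lemma has_derivative_lg:
  assumes "p \<in> U"
  shows "((\<lambda>q. lg (fst q)) has_derivative (\<lambda>X. fst X / fst p)) (at p)"
  using has_derivative_compose[OF has_derivative_fst[OF has_derivative_ident]
      DERIV_lg[of "fst p", unfolded has_field_derivative_def]] assms
  by simp

lemma has_derivative_alpha:
  assumes p: "(\<zeta>, u, v) \<in> U"
  shows "(np_alpha a has_derivative
    (\<lambda>X. np_alpha a (\<zeta>, u, v) * (m * fst X / \<zeta> - cnj ((m + 1) * fst X / \<zeta>)))) (at (\<zeta>, u, v))"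
proof -
  \<comment> \<open>Writing the reciprocal of \<open>cnj \<zeta>\<close> as
    \<open>k0 * exp (- cnj (lg \<zeta>))\<close> turns \<alpha> into a constant times one
    exponential. This extra term makes the conjugate part carry \<open>m + 1\<close> instead of
    \<open>m\<close>.\<close>
  let ?E = "\<lambda>q::point. m * lg (fst q) + K - cnj (m * lg (fst q) + K) - cnj (lg (fst q))"
  have *: "np_alpha a q = cnj m * of_real k0 * exp (?E q)" if "q \<in> U" for q
  proof -
    obtain z s w where q: "q = (z, s, w)" by (cases q)
    have z: "z \<in> fst ` U" using that q by force
    then have "exp (cnj (lg z)) = of_real k0 * cnj z"
      by (simp add: exp_lg flip: exp_cnj)
    then show ?thesis
      using that q k0 zeta_neq_0[OF z] by (simp add: alpha_eq a_eq[OF zu_projI] exp_diff)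
  qed
  have l: "((\<lambda>q. lg (fst q)) has_derivative (\<lambda>X. fst X / \<zeta>)) (at (\<zeta>, u, v))"
    using has_derivative_lg[OF p] by simp
  have "(?E has_derivative (\<lambda>X. m * (fst X / \<zeta>) - cnj (m * (fst X / \<zeta>)) - cnj (fst X / \<zeta>))) (at (\<zeta>, u, v))"
    by (rule derivative_eq_intros l refl)+ simp
  from has_derivative_mult_right[OF has_derivative_exp_complex[OF this], of "cnj m * of_real k0"]
  have "((\<lambda>q. cnj m * of_real k0 * exp (?E q)) has_derivative
     (\<lambda>X. np_alpha a (\<zeta>, u, v) * (m * fst X / \<zeta> - cnj ((m + 1) * fst X / \<zeta>)))) (at (\<zeta>, u, v))"
    by (rule has_derivative_eq_rhs) (auto simp: *[OF p] algebra_simps add_divide_distrib)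
  then show ?thesis
    by (rule has_derivative_transform_within_open[OF _ open_U p]) (simp add: *)
qed

lemma ext_d_alpha:
  assumes "(\<zeta>, u, v) \<in> U"
  shows "ext_d (np_alpha a) (\<zeta>, u, v) =
    (\<lambda>X. np_alpha a (\<zeta>, u, v) * (m * fst X / \<zeta> - cnj ((m + 1) * fst X / \<zeta>)))"
  unfolding ext_d_def using frechet_derivative_at[OF has_derivative_alpha[OF assms]] by simp

text \<open>As \<open>Z_u\<close> vanishes, only the derivative in \<open>cnj \<zeta>\<close>
  contributes. The factor \<open>exp (a - cnj a) / cnj \<zeta>\<close> that it produces is
  \<open>\<alpha> / cnj m\<close>, so dividing by the square of \<alpha> leaves a constant.\<close>

lemma inv_A_eq:
  assumes p: "(\<zeta>, u, v) \<in> U"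
  shows "inv_A a Z (\<zeta>, u, v) = - cnj ((m + 1) / m)"
proof -
  have \<zeta>: "\<zeta> \<noteq> 0" using p zeta_neq_0[OF zu_projD[OF zu_projI]] by simp
  have "d_zeta_bar (np_alpha a) (\<zeta>, u, v) = - np_alpha a (\<zeta>, u, v) * cnj ((m + 1) / \<zeta>)"
    using \<zeta> by (simp add: d_zeta_bar_def ext_d_alpha[OF p] field_simps)
  then have "np_delta_star a Z (np_alpha a) (\<zeta>, u, v)
      = - np_alpha a (\<zeta>, u, v) * (exp (a \<zeta> u - cnj (a \<zeta> u)) * cnj ((m + 1) / \<zeta>))"
    by (simp add: np_delta_star_def Z_u_eq_0[OF zu_projI[OF p]])
  also have "\<dots> = - (np_alpha a (\<zeta>, u, v))\<^sup>2 * cnj ((m + 1) / m)"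
    using \<zeta> m_neq_0 by (simp add: alpha_eq[OF p] power2_eq_square field_simps)
  finally show ?thesis
    using alpha_neq_0[OF p] by (simp add: inv_A_def)
qed

text \<open>The part of \<open>\<nu>\<close> that is not a function of \<open>\<alpha>\<close>.\<close>

definition N :: "point \<Rightarrow> complex" where
  "N = (\<lambda>(\<zeta>, u, v). exp (- (m * lg \<zeta> + K) - 3 * cnj (m * lg \<zeta> + K)) * cnj (g u))"

lemma N_eq_0_iff: "N (\<zeta>, u, v) = 0 \<longleftrightarrow> g u = 0"
  by (simp add: N_def)

section \<open>The spin coefficient \<nu> and the invariant \<open>Y\<close>\<close>

lemma nu_eq:
  assumes p: "p \<in> U"
  shows "np_nu f a Z p = cnj (m / (c - 1)) / np_alpha a p + N p"
proof -
  obtain \<zeta> u v where pe: "p = (\<zeta>, u, v)" by (cases p)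
  have zu: "(\<zeta>, u) \<in> zu_proj U" using p pe zu_projI by simp
  have \<zeta>: "\<zeta> \<noteq> 0" using zeta_neq_0[OF zu_projD[OF zu]] .
  let ?a = "a \<zeta> u"
  have c1: "c - 1 \<noteq> 0" using c_neq by simp
  \<comment> \<open>For a power, the first derivative is \<open>\<zeta> / (c - 1)\<close> times the
    second, and the second is \<open>exp (4 * a)\<close>.\<close>
  have "c * exp (c * lg \<zeta>) / \<zeta> = exp (4 * ?a) * \<zeta> / (c - 1)"
    unfolding exp_4a[OF zu] using \<zeta> c1 by (simp add: field_simps power2_eq_square)
  then have "cnj (f_z f \<zeta> u) = exp (4 * cnj ?a) * cnj (\<zeta> / (c - 1)) + cnj (g u)"
    by (simp add: f_z_eq[OF zu_projD[OF zu]] exp_cnj)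
  then have "np_nu f a Z p = exp (- ?a - 3 * cnj ?a) * exp (4 * cnj ?a) * cnj (\<zeta> / (c - 1)) + N p"
    by (simp add: np_nu_def pe Z_uu_eq_0[OF zu] N_def a_eq[OF zu] algebra_simps)
  also have "exp (- ?a - 3 * cnj ?a) * exp (4 * cnj ?a) = inverse (exp (?a - cnj ?a))"
    by (simp flip: exp_add exp_minus)
  \<comment> \<open>Expanding by \<open>x = cnj m\<close> makes \<alpha> appear in the
    denominator.\<close>
  also have "inverse E * (z / d) = x / d / (E * (x / z))" if "x \<noteq> 0" for E x d z :: complex
    using that by (simp add: divide_simps)
  from this[of "cnj m" "exp (?a - cnj ?a)" "cnj \<zeta>" "cnj (c - 1)"]
  have "inverse (exp (?a - cnj ?a)) * cnj (\<zeta> / (c - 1)) = cnj (m / (c - 1)) / np_alpha a p"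
    using m_neq_0 p by (simp add: pe alpha_eq)
  finally show ?thesis .
qed

text \<open>The \<mu> terms vanish, and \<open>3 - A\<close> is the conjugate of
  \<open>(4 * m + 1) / m = (c - 1) / m\<close>. This is the reciprocal of the coefficient of
  \<open>1 / \<alpha>\<close> in \<nu>, so the term \<open>- 1 / \<alpha>\<close> cancels.\<close>

lemma inv_Y_eq:
  assumes p: "p \<in> U"
  shows "inv_Y f a Z L p = cnj ((c - 1) / m) * N p"
proof -
  obtain \<zeta> u v where pe: "p = (\<zeta>, u, v)" by (cases p)
  have "c = 4 * m + 2" by (simp add: m_def field_simps)
  then have "3 + (m + 1) / m = (c - 1) / m"
    using m_neq_0 by (simp add: field_simps)
  from arg_cong[OF this, of cnj] have A: "3 - inv_A a Z p = cnj ((c - 1) / m)"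
    using p by (simp add: pe inv_A_eq)
  have "cnj ((c - 1) / m) * cnj (m / (c - 1)) = 1"
    using m_neq_0 c_neq by (simp flip: complex_cnj_mult)
  then show ?thesis
    unfolding inv_Y_def A mu_eq_0[OF p] Delta_mu_eq_0[OF p] nu_eq[OF p] distrib_left
      times_divide_eq_right by simp
qed

lemma inv_Y_eq_0_iff: "(\<zeta>, u, v) \<in> U \<Longrightarrow> inv_Y f a Z L (\<zeta>, u, v) = 0 \<longleftrightarrow> g u = 0"
  using c_neq m_neq_0 by (simp add: inv_Y_eq N_eq_0_iff)

section \<open>The wedge product of the differentials\<close>

text \<open>Regularity of \<open>g\<close> is inherited from \<open>f\<close>: at fixed \<zeta>
  subtract the power, which is constant in \<open>u\<close>, and divide by the nonzero
  \<zeta>.\<close>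

lemma g_differentiable:
  assumes zu: "(\<zeta>, u) \<in> zu_proj U"
  shows "g differentiable (at u)"
proof -
  have "Ck_on (Suc 0) (zu_proj U) (\<lambda>(\<zeta>, u). f \<zeta> u)"
    using wave unfolding vacuum_pp_wave_def smooth_on_def by blast
  then have "(\<lambda>(\<zeta>, u). f \<zeta> u) differentiable (at (\<zeta>, u))"
    using zu open_zu by (auto simp: differentiable_on_eq_differentiable_at)
  then obtain D where "((\<lambda>(\<zeta>, u). f \<zeta> u) has_derivative D) (at (\<zeta>, u))"
    unfolding differentiable_def by blast
  moreover have "((\<lambda>s. (\<zeta>, s)) has_derivative (\<lambda>s. (0, s))) (at u)"
    by (auto intro!: derivative_eq_intros)
  ultimately have "((\<lambda>s. f \<zeta> s) has_derivative (\<lambda>s. D (0, s))) (at u)"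
    using has_derivative_compose[of "\<lambda>s. (\<zeta>, s)" _ u UNIV "\<lambda>(\<zeta>, u). f \<zeta> u" D] by simp
  then have "(\<lambda>s. (f \<zeta> s - exp (2 * \<i> * of_real k1 * lg \<zeta>)) * (1 / \<zeta>)) differentiable (at u)"
    by (intro differentiable_mult differentiable_diff differentiable_const)
       (auto simp: differentiable_def)
  then show ?thesis
    using zeta_neq_0[OF zu_projD[OF zu]] by (simp add: f_eq AP13_def)
qed

text \<open>The wedge product is later tested on \<zeta>-directions only. There \<open>u\<close>
  does not move, so the derivative of \<open>g\<close> contributes \<open>g' 0 = 0\<close>.\<close>

lemma has_derivative_N:
  assumes p: "(\<zeta>, u, v) \<in> U"
  obtains N' where "(N has_derivative N') (at (\<zeta>, u, v))"
    and "\<And>h. N' (h, 0, 0) = N (\<zeta>, u, v) * (- (m * h / \<zeta>) - 3 * cnj (m * h / \<zeta>))"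
proof -
  obtain g' where g': "(g has_derivative g') (at u)"
    using g_differentiable[OF zu_projI[OF p]] unfolding differentiable_def by blast
  then have g'0: "g' 0 = 0"
    using has_derivative_linear linear_0 by blast
  let ?E = "\<lambda>q::point. - (m * lg (fst q) + K) - 3 * cnj (m * lg (fst q) + K)"
  have l: "((\<lambda>q. lg (fst q)) has_derivative (\<lambda>X. fst X / \<zeta>)) (at (\<zeta>, u, v))"
    using has_derivative_lg[OF p] by simp
  have "(?E has_derivative (\<lambda>X. - (m * (fst X / \<zeta>)) - 3 * cnj (m * (fst X / \<zeta>)))) (at (\<zeta>, u, v))"
    by (rule derivative_eq_intros l refl)+ simp
  note E = has_derivative_exp_complex[OF this]
  have "((\<lambda>q::point. fst (snd q)) has_derivative (\<lambda>X. fst (snd X))) (at (\<zeta>, u, v))"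
    by (intro derivative_intros)
  then have "((\<lambda>q::point. g (fst (snd q))) has_derivative (\<lambda>X. g' (fst (snd X)))) (at (\<zeta>, u, v))"
    by (rule has_derivative_compose) (simp add: g')
  then have "((\<lambda>q::point. cnj (g (fst (snd q)))) has_derivative (\<lambda>X. cnj (g' (fst (snd X))))) (at (\<zeta>, u, v))"
    by (rule has_derivative_cnj)
  from has_derivative_mult[OF E this]
  show thesis
    by (rule that[unfolded N_def case_prod_beta]) (simp add: g'0)
qed

text \<open>\<nu> is a constant multiple of \<open>1 / \<alpha>\<close> plus \<open>N\<close>, and
  the differential of \<open>1 / \<alpha>\<close> is proportional to that of \<alpha>, hence has
  zero wedge product with it.\<close>

lemma wedge_alpha_nu:
  assumes p: "p \<in> U" and N': "(N has_derivative N') (at p)"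
  shows "wedge (ext_d (np_alpha a) p) (ext_d (np_nu f a Z) p) X Y
    = wedge (ext_d (np_alpha a) p) N' X Y"
proof -
  let ?\<alpha> = "np_alpha a" and ?k = "cnj (m / (c - 1))"
  obtain \<zeta> u v where pe: "p = (\<zeta>, u, v)" by (cases p)
  have D: "(?\<alpha> has_derivative ext_d ?\<alpha> p) (at p)"
    using has_derivative_alpha p pe ext_d_alpha by simp
  have "((\<lambda>q. ?k * inverse (?\<alpha> q) + N q) has_derivative
     (\<lambda>X. ?k * - (inverse (?\<alpha> p) * ext_d ?\<alpha> p X * inverse (?\<alpha> p)) + N' X)) (at p)"
    by (intro has_derivative_add N' has_derivative_mult_right Deriv.has_derivative_inverse D)
       (use p pe alpha_neq_0 in auto)
  then have "(np_nu f a Z has_derivative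
     (\<lambda>X. ?k * - (inverse (?\<alpha> p) * ext_d ?\<alpha> p X * inverse (?\<alpha> p)) + N' X)) (at p)"
    by (rule has_derivative_transform_within_open[OF _ open_U p]) (simp add: nu_eq divide_inverse)
  then have "ext_d (np_nu f a Z) p =
     (\<lambda>X. ?k * - (inverse (?\<alpha> p) * ext_d ?\<alpha> p X * inverse (?\<alpha> p)) + N' X)"
    unfolding ext_d_def by (rule frechet_derivative_at[symmetric])
  then show ?thesis
    by (simp add: wedge_def algebra_simps)
qed

lemma wedge_zero_imp_g_zero:
  assumes p: "(\<zeta>, u, v) \<in> U"
    and w: "\<And>X Y. wedge (ext_d (np_alpha a) (\<zeta>, u, v)) (ext_d (np_nu f a Z) (\<zeta>, u, v)) X Y = 0"
  shows "g u = 0"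
proof -
  have \<zeta>: "\<zeta> \<noteq> 0" using p zeta_neq_0[OF zu_projD[OF zu_projI]] by simp
  obtain N' where N': "(N has_derivative N') (at (\<zeta>, u, v))"
    and N'h: "\<And>h. N' (h, 0, 0) = N (\<zeta>, u, v) * (- (m * h / \<zeta>) - 3 * cnj (m * h / \<zeta>))"
    using has_derivative_N[OF p] by blast
  let ?\<alpha> = "np_alpha a (\<zeta>, u, v)" and ?N = "N (\<zeta>, u, v)"
  \<comment> \<open>In \<zeta>-directions the logarithmic differential of \<alpha> has coefficients
    \<open>P\<close> and \<open>- Q\<close> on \<open>d\<zeta>\<close> and its conjugate; the
    differential of \<open>N\<close> is \<open>N\<close> times the form with coefficients
    \<open>- P\<close> and \<open>- 3 * R\<close>.\<close>
  define P Q R where PQR: "P = m / \<zeta>" "Q = cnj ((m + 1) / \<zeta>)" "R = cnj (m / \<zeta>)"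
  have "ext_d (np_alpha a) (\<zeta>, u, v) (1, 0, 0) = ?\<alpha> * (P - Q)"
    "ext_d (np_alpha a) (\<zeta>, u, v) (\<i>, 0, 0) = ?\<alpha> * \<i> * (P + Q)"
    "N' (1, 0, 0) = ?N * (- P - 3 * R)" "N' (\<i>, 0, 0) = ?N * \<i> * (3 * R - P)"
    by (simp_all add: ext_d_alpha[OF p] N'h PQR algebra_simps add_divide_distrib diff_divide_distrib)
  then have "wedge (ext_d (np_alpha a) (\<zeta>, u, v)) N' (1, 0, 0) (\<i>, 0, 0)
      = ?\<alpha> * (P - Q) * (?N * \<i> * (3 * R - P)) - ?\<alpha> * \<i> * (P + Q) * (?N * (- P - 3 * R))"
    by (simp add: wedge_def mult_ac)
  also have "\<dots> = 2 * \<i> * ?\<alpha> * ?N * P * (3 * R + Q)"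
    by (simp add: algebra_simps)
  \<comment> \<open>Again \<open>4 * m + 1 = c - 1\<close>, so this factor is nonzero and only
    \<open>N\<close> can vanish in the product.\<close>
  also have "3 * R + Q = cnj ((c - 1) / \<zeta>)"
    using \<zeta> by (simp add: PQR m_def field_simps)
  finally show ?thesis
    using w[of "(1, 0, 0)" "(\<i>, 0, 0)"] c_neq m_neq_0 \<zeta> alpha_neq_0[OF p]
    by (simp add: wedge_alpha_nu[OF p N'] PQR N_eq_0_iff)
qed

lemma g_zero_imp_wedge_zero:
  assumes p: "p \<in> U" and g: "\<forall>(\<zeta>, u, v)\<in>U. g u = 0"
  shows "wedge (ext_d (np_alpha a) p) (ext_d (np_nu f a Z) p) X Y = 0"
proof -
  have "(N has_derivative (\<lambda>_. 0)) (at p)"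
    by (rule has_derivative_transform_within_open[OF has_derivative_const open_U p, of 0])
       (use g in \<open>auto simp: N_def\<close>)
  then show ?thesis
    by (simp add: wedge_alpha_nu[OF p]) (simp add: wedge_def)
qed

end

theorem proposition8p2:
  fixes U :: "point set" and k0 k1 :: real and lg :: "complex \<Rightarrow> complex" and g :: "real \<Rightarrow> complex"
    and f a Z L :: "complex \<Rightarrow> real \<Rightarrow> complex"
  assumes "k0 \<noteq> 0" and "k1 \<noteq> 0"
    and "log_branch U k0 lg"
    and "f = AP13 k1 lg g"
    and "vacuum_pp_wave U f"
    and "adapted_functions U f a Z L"
  shows "((\<forall>p\<in>U. \<forall>X Y. wedge (ext_d (np_alpha a) p) (ext_d (np_nu f a Z) p) X Y = 0)
            \<longleftrightarrow> (\<forall>p\<in>U. inv_Y f a Z L p = 0))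
       \<and> ((\<forall>p\<in>U. inv_Y f a Z L p = 0) \<longleftrightarrow> (\<forall>(\<zeta>, u, v)\<in>U. g u = 0))"
proof -
  interpret AP13_wave U k0 k1 lg g f a Z L
    using assms by unfold_locales
  have "(\<forall>p\<in>U. inv_Y f a Z L p = 0) \<longleftrightarrow> (\<forall>(\<zeta>, u, v)\<in>U. g u = 0)"
    by (auto simp: inv_Y_eq_0_iff)
  \<comment> \<open>The forward direction works point by point; the converse differentiates
    \<open>N\<close> around \<open>p\<close> and so uses \<open>g u = 0\<close> throughout
    \<open>U\<close>.\<close>
  moreover have "(\<forall>p\<in>U. \<forall>X Y. wedge (ext_d (np_alpha a) p) (ext_d (np_nu f a Z) p) X Y = 0)
      \<longleftrightarrow> (\<forall>(\<zeta>, u, v)\<in>U. g u = 0)"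
    using wedge_zero_imp_g_zero g_zero_imp_wedge_zero by (auto simp: Ball_def split_paired_all)
  ultimately show ?thesis
    by simp
qed

end
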